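(* Let $(X,d)$ be a geodesic metric space. Then $X$ is hyperbolic if and only if there is a constant $C\ge 0$ such that for all $x,y\in X$ and all $s,t\ge 0$ with $B(x,s)\cap B(y,t)\neq\emptyset$ there exist $\xi\in X$ and $R\ge 0$ with $d_H\big(B(x,s)\cap B(y,t),\,B(\xi,R)\big)\le C$.
   Context: $B(x,r)=\{z\in X: d(x,z)\le r\}$ denotes the closed ball. For $A,B\subseteq X$, the Hausdorff distance is $d_H(A,B)=\inf\{r\ge 0: A\subseteq N_r(B),\ B\subseteq N_r(A)\}$, where $N_r(A)$ is the $r$-neighbourhood of $A$. A geodesic metric space is $\delta$-hyperbolic ($\delta\ge0$) if for every geodesic triangle each side is contained in the $\delta$-neighbourhood of the union of the other two sides; it is hyperbolic if it is $\delta$-hyperbolic for some $\delta\ge0$. *)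

theory Defs
  imports "HOL-Analysis.Analysis"
begin

definition nbhd :: "real \<Rightarrow> 'a::metric_space set \<Rightarrow> 'a set" where
  "nbhd r A = {z. \<exists>a\<in>A. dist z a < r}"

definition hausdorff_dist :: "'a::metric_space set \<Rightarrow> 'a set \<Rightarrow> real" where
  "hausdorff_dist A B = Inf {r. r \<ge> 0 \<and> A \<subseteq> nbhd r B \<and> B \<subseteq> nbhd r A}"

definition geodesic_segment_between :: "'a::metric_space set \<Rightarrow> 'a \<Rightarrow> 'a \<Rightarrow> bool" where
  "geodesic_segment_between G x y \<longleftrightarrow>
     (\<exists>\<gamma>::real \<Rightarrow> 'a. \<gamma> 0 = x \<and> \<gamma> (dist x y) = y \<and>
        (\<forall>s\<in>{0..dist x y}. \<forall>t\<in>{0..dist x y}. dist (\<gamma> s) (\<gamma> t) = \<bar>s - t\<bar>) \<and>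
        G = \<gamma> ` {0..dist x y})"

definition geodesic_space :: "'a::metric_space itself \<Rightarrow> bool" where
  "geodesic_space _ \<longleftrightarrow> (\<forall>x y::'a. \<exists>G. geodesic_segment_between G x y)"

definition delta_hyperbolic :: "'a::metric_space itself \<Rightarrow> real \<Rightarrow> bool" where
  "delta_hyperbolic _ \<delta> \<longleftrightarrow> \<delta> \<ge> 0 \<and>
     (\<forall>(x::'a) y z Gxy Gyz Gxz.
        geodesic_segment_between Gxy x y \<and> geodesic_segment_between Gyz y z \<and>
        geodesic_segment_between Gxz x z \<longrightarrow>
        Gxy \<subseteq> nbhd \<delta> (Gyz \<union> Gxz) \<and> Gyz \<subseteq> nbhd \<delta> (Gxy \<union> Gxz) \<and>
        Gxz \<subseteq> nbhd \<delta> (Gxy \<union> Gyz))"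

definition hyperbolic :: "'a::metric_space itself \<Rightarrow> bool" where
  "hyperbolic T \<longleftrightarrow> (\<exists>\<delta>\<ge>0. delta_hyperbolic T \<delta>)"

end

theory Submission
  imports Defs
begin

text \<open>
  In a hyperbolic space two overlapping balls meet in a set close to the ball centred on the
  geodesic between their centres, of radius half the overlap.

  Conversely, let \<open>m\<close> be the point of a geodesic in the middle of the overlap \<open>2\<rho>\<close> of two balls around
  its ends. The ball \<open>B(\<xi>,R)\<close> close to their intersection has \<open>R \<le> 2\<rho> + const\<close>, unless \<open>\<xi>\<close> is
  close to an end: walking from \<open>\<xi>\<close> towards an end must not leave the intersection. So the
  intersection lies in a ball around \<open>m\<close> of radius linear in \<open>\<rho>\<close>. A pigeonhole argument on almost
  geodesic crossings then shows that two geodesics staying \<open>w\<close>-close over a length \<open>const * w\<close>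
  come \<open>(3/4)w\<close>-close for large \<open>w\<close>, hence two geodesics from a common point with ends at distance \<open>w\<close> are
  uniformly close outside a ball of radius \<open>const * w\<close> around the ends. Moving the end along a
  side \<open>[m,x]\<close> whose point nearest to \<open>z\<close> is \<open>m\<close>, in a bounded number of steps of size proportional to
  \<open>dist z m\<close>, shows that \<open>[z,x]\<close> follows \<open>[z,m]\<close> halfway to \<open>m\<close>; repeated halving brings it near
  \<open>m\<close>. Thus \<open>[z,m]\<close> followed by \<open>[m,x]\<close> is almost geodesic, and triangles are slim.
\<close>

section \<open>Geodesics\<close>

definition geod :: "(real \<Rightarrow> 'a::metric_space) \<Rightarrow> real \<Rightarrow> bool" where
  "geod g L \<longleftrightarrow> 0 \<le> L \<and> (\<forall>s\<in>{0..L}. \<forall>t\<in>{0..L}. dist (g s) (g t) = \<bar>s - t\<bar>)"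

lemma geod_nonneg: "geod g L \<Longrightarrow> 0 \<le> L"
  by (simp add: geod_def)

lemma geod_dist:
  "\<lbrakk>geod g L; 0 \<le> s; s \<le> L; 0 \<le> t; t \<le> L\<rbrakk> \<Longrightarrow> dist (g s) (g t) = \<bar>s - t\<bar>"
  by (simp add: geod_def)

lemma geod_ends: "geod g L \<Longrightarrow> dist (g 0) (g L) = L"
  by (simp add: geod_def)

lemma geod_sub: "\<lbrakk>geod g L; 0 \<le> a; a \<le> b; b \<le> L\<rbrakk> \<Longrightarrow> geod (\<lambda>t. g (a + t)) (b - a)"
  by (simp add: geod_def)

lemma geod_prefix: "\<lbrakk>geod g L; 0 \<le> b; b \<le> L\<rbrakk> \<Longrightarrow> geod g b"
  by (simp add: geod_def)

lemma geod_rev: "geod g L \<Longrightarrow> geod (\<lambda>t. g (L - t)) L"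
  by (simp add: geod_def abs_minus_commute)

lemma segment_iff_geod:
  "geodesic_segment_between G x y \<longleftrightarrow>
    (\<exists>g. geod g (dist x y) \<and> g 0 = x \<and> g (dist x y) = y \<and> G = g ` {0..dist x y})"
  by (auto simp: geodesic_segment_between_def geod_def)

lemma geod_imp_segment:
  assumes "geod g L" "g 0 = x" "g L = y"
  shows "geodesic_segment_between (g ` {0..L}) x y"
proof -
  have *: "dist x y = L"
    using geod_ends[OF assms(1)] assms by simp
  show ?thesis
    unfolding segment_iff_geod * using assms by blast
qed

lemma geodesic_segment_commute:
  assumes "geodesic_segment_between G x y"
  shows "geodesic_segment_between G y x"
proof -
  obtain g where g: "geod g (dist x y)" "g 0 = x" "g (dist x y) = y" "G = g ` {0..dist x y}"
    using assms unfolding segment_iff_geod by blast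
  have "(\<lambda>t. g (d - t)) ` {0..d} = g ` {0..d}" for d
    unfolding image_image[of g "\<lambda>t. d - t" "{0..d}", symmetric]
      image_diff_atLeastAtMost by simp
  then show ?thesis
    unfolding segment_iff_geod using g geod_rev[OF g(1)]
    by (intro exI[of _ "\<lambda>t. g (dist x y - t)"]) (simp add: dist_commute)
qed

lemma geodesic_spaceE:
  assumes "geodesic_space TYPE('a::metric_space)"
  obtains g where "geod g (dist x y)" "g 0 = (x::'a)" "g (dist x y) = y"
  using assms unfolding geodesic_space_def segment_iff_geod by blast

section \<open>Slim triangles from a linear lens bound\<close>

text \<open>For \<open>z\<close> in the lens of the two balls around the ends of a geodesic that overlap by \<open>2\<rho>\<close>,
  the axiom bounds the distance to the point of the geodesic in the middle of the overlap.\<close>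

locale lens_space =
  fixes T :: "'a::metric_space itself" and K :: real
  assumes K_pos: "0 < K"
    and geodesic: "\<exists>g. geod g (dist x y) \<and> g 0 = (x::'a) \<and> g (dist x y) = y"
    and lens: "\<lbrakk>geod (g :: real \<Rightarrow> 'a) L; 0 \<le> \<tau>; \<tau> \<le> L; 0 \<le> \<rho>;
      dist (g 0) z \<le> \<tau> + \<rho>; dist (g L) z \<le> L - \<tau> + \<rho>\<rbrakk> \<Longrightarrow> dist z (g \<tau>) \<le> 7 * \<rho> + K"
begin

section \<open>Crossing between nearby geodesics\<close>

lemma fan:
  fixes g g' :: "real \<Rightarrow> 'a"
  assumes "geod g \<tau>" "geod g' \<tau>" "g 0 = g' 0" "0 \<le> t" "t \<le> \<tau>" "dist (g \<tau>) (g' \<tau>) \<le> w"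
  shows "dist (g t) (g' t) \<le> 7 * w + K"
proof (rule lens)
  \<comment> \<open>\<open>g t\<close> is a lens point for \<open>g'\<close> at time
    \<open>t\<close>, with \<open>w\<close> as \<open>\<rho>\<close>.\<close>
  show "dist (g' 0) (g t) \<le> t + w"
    using geod_dist[OF assms(1), of 0 t] assms order_trans[OF zero_le_dist assms(6)] by simp
  show "dist (g' \<tau>) (g t) \<le> \<tau> - t + w"
    using geod_dist[OF assms(1), of \<tau> t] assms dist_triangle[of "g' \<tau>" "g t" "g \<tau>"]
    by (simp add: dist_commute)
qed (use assms order_trans[OF zero_le_dist assms(6)] in auto)

text \<open>The length of a crossing from \<open>g\<close> to \<open>g'\<close> beyond the elapsed
  time; it may be negative, as no common start is assumed.\<close>

definition excess :: "(real \<Rightarrow> 'a) \<Rightarrow> (real \<Rightarrow> 'a) \<Rightarrow> real \<Rightarrow> real \<Rightarrow> real" where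
  "excess g g' s t = dist (g s) (g' t) - (t - s)"

lemma abs_excess_le:
  assumes "geod g' L" "dist (g s) (g' s) \<le> W" "0 \<le> s" "s \<le> t" "t \<le> L"
  shows "\<bar>excess g g' s t\<bar> \<le> W"
  using geod_dist[OF assms(1), of s t] assms dist_triangle[of "g s" "g' t" "g' s"]
    dist_triangle[of "g' s" "g' t" "g s"]
  by (simp add: excess_def dist_commute)

text \<open>The excess decreases when the interval grows. Passing to an outer third with larger excess
  can be repeated only finitely often, since the excess is bounded.\<close>

lemma excess_pigeonhole:
  fixes g g' :: "real \<Rightarrow> 'a" and \<epsilon> :: real
  assumes "geod g' L" "\<And>t. 0 \<le> t \<Longrightarrow> t \<le> L \<Longrightarrow> dist (g t) (g' t) \<le> W" "0 \<le> W" "0 \<le> \<epsilon>"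
    and "0 \<le> a" "b \<le> L" "3 ^ n * (3 * W) \<le> b - a" "W - n * \<epsilon> \<le> excess g g' a b"
  shows "\<exists>a p q b. 0 \<le> a \<and> a + W \<le> p \<and> p + W \<le> q \<and> q \<le> b \<and> b \<le> L \<and>
    excess g g' a p \<le> excess g g' a b + \<epsilon> \<and> excess g g' q b \<le> excess g g' a b + \<epsilon>"
  using assms(5-)
proof (induction n arbitrary: a b)
  case 0
  \<comment> \<open>The excess is now at least its upper bound \<open>W\<close>, so any two outer
    intervals of length \<open>W\<close> will do.\<close>
  then show ?case
    using assms(2)[of a] assms(2)[of "b - W"] assms(3,4)
      abs_excess_le[OF assms(1), of g a W "a + W"] abs_excess_le[OF assms(1), of g "b - W" W b]
    by (intro exI[of _ a] exI[of _ "a + W"] exI[of _ "b - W"] exI[of _ b]) auto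
next
  case (Suc n)
  define p where "p = a + (b - a) / 3"
  define q where "q = b - (b - a) / 3"
  have third: "3 ^ n * (3 * W) \<le> (b - a) / 3"
    using Suc.prems by simp
  moreover have "1 * (3 * W) \<le> 3 ^ n * (3 * W)"
    using assms(3) by (intro mult_right_mono one_le_power) auto
  ultimately have W: "W \<le> (b - a) / 3"
    using assms(3) by linarith
  then have "p \<le> L \<and> 0 \<le> q \<and> a + W \<le> p \<and> p + W \<le> q \<and> q \<le> b"
    using Suc.prems(1,2) assms(3) unfolding p_def q_def by argo
  then have pq: "p \<le> L" "0 \<le> q" "a + W \<le> p" "p + W \<le> q" "q \<le> b"
    by auto
  consider "excess g g' a b + \<epsilon> < excess g g' a p" | "excess g g' a b + \<epsilon> < excess g g' q b"
    | "excess g g' a p \<le> excess g g' a b + \<epsilon>" "excess g g' q b \<le> excess g g' a b + \<epsilon>"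
    by linarith
  then show ?case
  proof cases
    case 1
    then have "W - n * \<epsilon> \<le> excess g g' a p"
      using Suc.prems(4) by (simp add: algebra_simps)
    then show ?thesis
      using Suc.prems third pq by (intro Suc.IH[of a p]) (auto simp: p_def)
  next
    case 2
    then have "W - n * \<epsilon> \<le> excess g g' q b"
      using Suc.prems(4) by (simp add: algebra_simps)
    then show ?thesis
      using Suc.prems third pq by (intro Suc.IH[of q b]) (auto simp: q_def)
  next
    case 3
    then show ?thesis
      using Suc.prems(1,2) pq by blast
  qed
qed

text \<open>If both outer thirds have nearly the excess of the whole interval, then crossing early
  from \<open>g\<close> to \<open>g'\<close> and crossing late are both almost geodesic, so they meet the geodesic between
  the same ends.\<close>

lemma parallel_close:
  fixes g g' :: "real \<Rightarrow> 'a" and \<epsilon> :: real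
  assumes g: "geod g L" and g': "geod g' L"
    and W: "\<And>t. 0 \<le> t \<Longrightarrow> t \<le> L \<Longrightarrow> dist (g t) (g' t) \<le> W" "0 \<le> W"
    and \<epsilon>: "0 \<le> \<epsilon>" "2 * W \<le> n * \<epsilon>" and L: "3 ^ n * (3 * W) \<le> L"
  shows "\<exists>p q. 0 \<le> p \<and> p \<le> L \<and> 0 \<le> q \<and> q \<le> L \<and> dist (g q) (g' p) \<le> 14 * \<epsilon> + 2 * K"
proof -
  have "\<bar>excess g g' 0 L\<bar> \<le> W"
    by (rule abs_excess_le[OF g']) (use W geod_nonneg[OF g] in auto)
  then have "W - n * \<epsilon> \<le> excess g g' 0 L"
    using \<epsilon>(2) by linarith
  then obtain a p q b where ab: "0 \<le> a" "a + W \<le> p" "p + W \<le> q" "q \<le> b" "b \<le> L"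
    and ex: "excess g g' a p \<le> excess g g' a b + \<epsilon>" "excess g g' q b \<le> excess g g' a b + \<epsilon>"
    using excess_pigeonhole[OF g' W \<epsilon>(1), of 0 L n] L by auto
  define F where "F = excess g g' a b"
  have F: "\<bar>F\<bar> \<le> W"
    unfolding F_def by (rule abs_excess_le[OF g']) (use W ab in auto)
  \<comment> \<open>The shift by \<open>F\<close> makes \<open>g q'\<close> and \<open>g' p\<close>
    both fit time \<open>q' - a\<close> on \<open>\<sigma>\<close>, since
    \<open>b - p = D - (q' - a)\<close>. The gaps of \<open>W\<close> on both sides of
    \<open>p\<close> absorb it.\<close>
  define q' where "q' = p + F"
  have q': "a \<le> q'" "q' \<le> q"
    using F ab unfolding q'_def by auto
  define D where "D = dist (g a) (g' b)"
  have D: "D = b - a + F"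
    unfolding D_def F_def excess_def by simp
  obtain \<sigma> where \<sigma>: "geod \<sigma> D" "\<sigma> 0 = g a" "\<sigma> D = g' b"
    using geodesic[of "g a" "g' b"] unfolding D_def by auto
  have pos: "0 \<le> q' - a" "q' - a \<le> D"
    using q' ab W(2) unfolding D q'_def by auto
  have "dist (g q') (\<sigma> (q' - a)) \<le> 7 * \<epsilon> + K"
  proof (rule lens[OF \<sigma>(1) pos \<epsilon>(1)])
    show "dist (\<sigma> 0) (g q') \<le> q' - a + \<epsilon>"
      using geod_dist[OF g, of a q'] q' ab W(2) \<epsilon>(1) \<sigma> by simp
    have "dist (g q') (g' b) \<le> (q - q') + dist (g q) (g' b)"
      using geod_dist[OF g, of q' q] q' ab W(2) dist_triangle[of "g q'" "g' b" "g q"] by simp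
    then have "dist (g q') (g' b) \<le> D - (q' - a) + \<epsilon>"
      using ex(2) by (simp add: D_def excess_def)
    then show "dist (\<sigma> D) (g q') \<le> D - (q' - a) + \<epsilon>"
      using \<sigma>(3) by (simp add: dist_commute)
  qed
  moreover have "dist (g' p) (\<sigma> (q' - a)) \<le> 7 * \<epsilon> + K"
  proof (rule lens[OF \<sigma>(1) pos \<epsilon>(1)])
    show "dist (\<sigma> 0) (g' p) \<le> q' - a + \<epsilon>"
      using ex(1) \<sigma>(2) by (simp add: q'_def F_def excess_def)
    show "dist (\<sigma> D) (g' p) \<le> D - (q' - a) + \<epsilon>"
      using geod_dist[OF g', of b p] ab W(2) \<epsilon>(1) \<sigma>(3) D by (simp add: q'_def)
  qed
  ultimately have "dist (g q') (g' p) \<le> 14 * \<epsilon> + 2 * K"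
    using dist_triangle2[of "g q'" "g' p" "\<sigma> (q' - a)"] by simp
  then show ?thesis
    using q' ab W(2) by (intro exI[of _ p] exI[of _ q']) auto
qed

section \<open>Merging of geodesics with a common start\<close>

lemma dist_same_time:
  fixes g g' :: "real \<Rightarrow> 'a"
  assumes "geod g L" "geod g' L'" "g 0 = g' 0" "0 \<le> q" "q \<le> L" "0 \<le> p" "p \<le> L" "p \<le> L'"
    "dist (g q) (g' p) \<le> e"
  shows "dist (g p) (g' p) \<le> 2 * e"
proof -
  have "dist (g 0) (g q) = q" "dist (g 0) (g' p) = p" "dist (g p) (g q) = \<bar>p - q\<bar>"
    using geod_dist[OF assms(1), of 0 q] geod_dist[OF assms(2), of 0 p]
      geod_dist[OF assms(1), of p q] geod_nonneg assms by auto
  \<comment> \<open>Times are distances from the common start, so they differ by no more than the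
    points do.\<close>
  moreover from this have "\<bar>p - q\<bar> \<le> dist (g q) (g' p)"
    using dist_triangle[of "g 0" "g q" "g' p"] dist_triangle[of "g 0" "g' p" "g q"]
    by (simp add: dist_commute)
  ultimately show ?thesis
    using dist_triangle[of "g p" "g' p" "g q"] assms(9) by simp
qed

text \<open>The depth \<open>896 = 16 * 56\<close> is what \<open>parallel_close\<close> needs for width \<open>8 w\<close> and
  \<open>\<epsilon> = w / 56\<close>.\<close>

definition depth :: nat where "depth = 896"
text \<open>A quarter of \<open>B * w\<close> is the length that \<open>parallel_close\<close> needs
  at width \<open>8 * w\<close>. The factor 4 is the sum of the powers of 3/4, the shrinking ratio
  in \<open>merge_step\<close>.\<close>

definition B :: real where "B = 4 * (8 * (3 * 3 ^ depth))"
definition M :: real where "M = 113 * K"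

lemma B_ge_1: "1 \<le> B"
  using one_le_power[of "3::real" depth] unfolding B_def by linarith

lemma M_pos: "0 < M"
  using K_pos by (simp add: M_def)

text \<open>On the last stretch, of length \<open>B / 4 * w\<close>, \<open>fan\<close> bounds the
  width by \<open>8 * w\<close>. The crossing found there has length at most
  \<open>w / 4 + 2 * K\<close>; passing to equal times doubles this.\<close>

lemma merge_step:
  fixes g g' :: "real \<Rightarrow> 'a"
  assumes g: "geod g \<tau>" "geod g' \<tau>" "g 0 = g' 0"
    and w: "dist (g \<tau>) (g' \<tau>) \<le> w" "16 * K \<le> w" and \<tau>: "B / 4 * w \<le> \<tau>"
  shows "\<exists>p. \<tau> - B / 4 * w \<le> p \<and> p \<le> \<tau> \<and> dist (g p) (g' p) \<le> 3 / 4 * w"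
proof -
  define a where "a = \<tau> - B / 4 * w"
  have w0: "0 < w"
    using w K_pos by linarith
  have "0 \<le> B / 4 * w"
    using B_ge_1 w0 by simp
  then have a: "0 \<le> a" "a \<le> \<tau>"
    using \<tau> by (auto simp: a_def)
  have "\<exists>p q. 0 \<le> p \<and> p \<le> \<tau> - a \<and> 0 \<le> q \<and> q \<le> \<tau> - a \<and>
      dist (g (a + q)) (g' (a + p)) \<le> 14 * (w / 56) + 2 * K"
  proof (rule parallel_close)
    show "geod (\<lambda>t. g (a + t)) (\<tau> - a)" "geod (\<lambda>t. g' (a + t)) (\<tau> - a)"
      using geod_sub g a by auto
    fix t assume "0 \<le> t" "t \<le> \<tau> - a"
    then show "dist (g (a + t)) (g' (a + t)) \<le> 8 * w"
      using fan[OF g, of "a + t" w] a w K_pos by simp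
  next
    show "2 * (8 * w) \<le> real depth * (w / 56)"
      by (simp add: depth_def)
    show "3 ^ depth * (3 * (8 * w)) \<le> \<tau> - a"
      by (simp add: a_def B_def)
  qed (use w0 in auto)
  then obtain p q where pq: "0 \<le> p" "p \<le> \<tau> - a" "0 \<le> q" "q \<le> \<tau> - a"
    "dist (g (a + q)) (g' (a + p)) \<le> w / 4 + 2 * K" by auto
  then have "dist (g (a + p)) (g' (a + p)) \<le> 2 * (w / 4 + 2 * K)"
    using a by (intro dist_same_time[OF g, of "a + q"]) auto
  then show ?thesis
    using pq w a by (intro exI[of _ "a + p"]) (auto simp: a_def)
qed

text \<open>A step uses up \<open>B / 4 * w\<close>, and the rest \<open>B * (3 / 4 * w)\<close> is
  the budget for the new width; \<open>n\<close> bounds the number of steps.\<close>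

lemma merge_iterate:
  fixes g g' :: "real \<Rightarrow> 'a"
  assumes "geod g \<tau>" "geod g' \<tau>" "g 0 = g' 0" "dist (g \<tau>) (g' \<tau>) \<le> w" "0 \<le> w" "B * w \<le> \<tau>"
    "w \<le> (4 / 3) ^ n * (16 * K)"
  shows "\<exists>p. \<tau> - B * w \<le> p \<and> p \<le> \<tau> \<and> dist (g p) (g' p) \<le> 16 * K"
  using assms
proof (induction n arbitrary: \<tau> w)
  case 0
  moreover have "0 \<le> B * w"
    using B_ge_1 0 by simp
  ultimately show ?case
    by (intro exI[of _ \<tau>]) auto
next
  case (Suc n)
  have Bw: "0 \<le> B * w"
    using B_ge_1 Suc.prems by simp
  show ?case
  proof (cases "w \<le> 16 * K")
    case True
    then show ?thesis
      using Suc.prems Bw by (intro exI[of _ \<tau>]) auto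
  next
    case False
    then obtain p where p: "\<tau> - B / 4 * w \<le> p" "p \<le> \<tau>" "dist (g p) (g' p) \<le> 3 / 4 * w"
      using merge_step[of g \<tau> g' w] Suc.prems Bw by auto
    have "0 \<le> p"
      using p Bw Suc.prems by simp
    have "\<exists>r. p - B * (3 / 4 * w) \<le> r \<and> r \<le> p \<and> dist (g r) (g' r) \<le> 16 * K"
    proof (rule Suc.IH)
      show "geod g p" "geod g' p"
        using geod_prefix[OF Suc.prems(1)] geod_prefix[OF Suc.prems(2)] \<open>0 \<le> p\<close> p by auto
    qed (use Suc.prems p in \<open>auto simp: algebra_simps\<close>)
    then obtain r where "p - B * (3 / 4 * w) \<le> r" "r \<le> p" "dist (g r) (g' r) \<le> 16 * K"
      by blast
    then show ?thesis
      using p by (intro exI[of _ r]) auto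
  qed
qed

text \<open>Below a time at which the width has shrunk to \<open>16 * K\<close>, \<open>fan\<close>
  gives \<open>7 * (16 * K) + K = M\<close>, whatever \<open>w\<close> was.\<close>

lemma merge:
  fixes g g' :: "real \<Rightarrow> 'a"
  assumes "geod g \<tau>" "geod g' \<tau>" "g 0 = g' 0" "dist (g \<tau>) (g' \<tau>) \<le> w"
    "0 \<le> t" "t \<le> \<tau> - B * w"
  shows "dist (g t) (g' t) \<le> M"
proof -
  have w: "0 \<le> w"
    using assms(4) zero_le_dist order_trans by blast
  obtain n where "w / (16 * K) < (4 / 3) ^ n"
    using real_arch_pow[of "4/3" "w / (16 * K)"] by auto
  then have n: "w \<le> (4 / 3) ^ n * (16 * K)"
    using K_pos by (simp add: field_simps)
  obtain p where p: "\<tau> - B * w \<le> p" "p \<le> \<tau>" "dist (g p) (g' p) \<le> 16 * K"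
    using merge_iterate[OF assms(1-4) w _ n] assms by auto
  have "dist (g t) (g' t) \<le> 7 * (16 * K) + K"
  proof (rule fan[of g p g'])
    show "geod g p" "geod g' p"
      using geod_prefix[OF assms(1)] geod_prefix[OF assms(2)] assms p by auto
  qed (use assms p in auto)
  then show ?thesis
    by (simp add: M_def)
qed

lemma dist_at_min:
  fixes g g' :: "real \<Rightarrow> 'a"
  assumes "geod g L" "geod g' L'" "g 0 = g' 0" "dist (g L) (g' L') \<le> w"
  shows "dist (g (min L L')) (g' (min L L')) \<le> 2 * w" "\<bar>L - L'\<bar> \<le> w"
proof -
  have L: "0 \<le> L" "0 \<le> L'" "dist (g 0) (g L) = L" "dist (g 0) (g' L') = L'"
    using geod_nonneg geod_ends assms by metis+
  then show 1: "\<bar>L - L'\<bar> \<le> w"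
    using dist_triangle[of "g 0" "g L" "g' L'"] dist_triangle[of "g 0" "g' L'" "g L"] assms
    by (simp add: dist_commute)
  show "dist (g (min L L')) (g' (min L L')) \<le> 2 * w"
  proof (cases "L \<le> L'")
    case True
    then show ?thesis
      using geod_dist[OF assms(2), of L L'] L 1 assms dist_triangle[of "g L" "g' L" "g' L'"]
      by (simp add: dist_commute)
  next
    case False
    then show ?thesis
      using geod_dist[OF assms(1), of L L'] L 1 assms dist_triangle[of "g L'" "g' L'" "g L"]
      by (simp add: dist_commute)
  qed
qed

text \<open>Cutting to the shorter length at most doubles the gap between the ends, hence
  \<open>2 * B\<close>.\<close>

lemma merge_ends:
  fixes g g' :: "real \<Rightarrow> 'a"
  assumes "geod g L" "geod g' L'" "g 0 = g' 0" "dist (g L) (g' L') \<le> w"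
    "0 \<le> t" "t \<le> L - 2 * B * w" "t \<le> L' - 2 * B * w"
  shows "dist (g t) (g' t) \<le> M"
proof (rule merge)
  show "geod g (min L L')" "geod g' (min L L')"
    using assms geod_prefix geod_nonneg by (metis min.cobounded1 min.cobounded2 min_def)+
  show "dist (g (min L L')) (g' (min L L')) \<le> 2 * w"
    by (rule dist_at_min[OF assms(1-4)])
qed (use assms in auto)

section \<open>Moving the end of a geodesic along a side\<close>

lemma chain:
  fixes \<alpha> \<beta> \<mu> :: "real \<Rightarrow> 'a" and l w :: real and n :: nat
  assumes "geod \<alpha> l" "\<And>s. 0 \<le> s \<Longrightarrow> s \<le> l \<Longrightarrow> h \<le> dist z (\<alpha> s)"
    "geod \<mu> (dist z (\<alpha> 0))" "\<mu> 0 = z" "\<mu> (dist z (\<alpha> 0)) = \<alpha> 0"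
    "geod \<beta> (dist z (\<alpha> l))" "\<beta> 0 = z" "\<beta> (dist z (\<alpha> l)) = \<alpha> l"
    "l \<le> n * w" "0 \<le> w" "0 \<le> t" "t \<le> h - 2 * B * w"
  shows "dist (\<mu> t) (\<beta> t) \<le> (n + 1) * M"
  using assms(1-9)
proof (induction n arbitrary: l \<beta>)
  case 0
  then have "l = 0"
    using geod_nonneg[OF 0(1)] by simp
  \<comment> \<open>\<open>\<mu>\<close> and \<open>\<beta>\<close> share both ends but may differ,
    which accounts for the \<open>+ 1\<close> in the bound.\<close>
  have "dist (\<mu> t) (\<beta> t) \<le> M"
  proof (rule merge_ends)
    show "geod \<mu> (dist z (\<alpha> 0))" "geod \<beta> (dist z (\<alpha> l))"
      using 0 by auto
    show "dist (\<mu> (dist z (\<alpha> 0))) (\<beta> (dist z (\<alpha> l))) \<le> w"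
      using 0 \<open>l = 0\<close> assms(10) by simp
  qed (use 0 assms(10-) \<open>l = 0\<close> 0(2)[of 0] in auto)
  then show ?case by simp
next
  case (Suc n)
  define l' where "l' = max 0 (l - w)"
  have l: "0 \<le> l'" "l' \<le> l" "l - l' \<le> w" "l' \<le> n * w"
    using geod_nonneg[OF Suc.prems(1)] assms(10) Suc.prems(9)
    by (auto simp: l'_def algebra_simps)
  obtain \<gamma> where \<gamma>: "geod \<gamma> (dist z (\<alpha> l'))" "\<gamma> 0 = z" "\<gamma> (dist z (\<alpha> l')) = \<alpha> l'"
    using geodesic by blast
  have "dist (\<mu> t) (\<gamma> t) \<le> (n + 1) * M"
  proof (rule Suc.IH)
    show "geod \<alpha> l'"
      using geod_prefix[OF Suc.prems(1)] l by simp
  qed (use Suc.prems l \<gamma> in auto)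
  \<comment> \<open>A step of length at most \<open>w\<close> costs \<open>M\<close>; as all of
    \<open>\<alpha>\<close> is at distance at least \<open>h\<close> from \<open>z\<close>, the same
    \<open>t\<close> is admissible in every step.\<close>
  moreover have "dist (\<gamma> t) (\<beta> t) \<le> M"
  proof (rule merge_ends)
    show "geod \<gamma> (dist z (\<alpha> l'))" "geod \<beta> (dist z (\<alpha> l))"
      using \<gamma> Suc.prems by auto
    show "dist (\<gamma> (dist z (\<alpha> l'))) (\<beta> (dist z (\<alpha> l))) \<le> w"
      using geod_dist[OF Suc.prems(1), of l' l] l \<gamma> Suc.prems by simp
    show "t \<le> dist z (\<alpha> l') - 2 * B * w" "t \<le> dist z (\<alpha> l) - 2 * B * w"
      using assms(12) l Suc.prems(2)[of l] Suc.prems(2)[of l'] by linarith+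
  qed (use \<gamma> Suc.prems assms(11) in auto)
  ultimately show ?case
    using dist_triangle[of "\<mu> t" "\<beta> t" "\<gamma> t"] by (simp add: algebra_simps)
qed

text \<open>The number of steps of length \<open>h / (4 * B)\<close> that cover
  \<open>(2 * B + 1) * h\<close>, whatever \<open>h\<close> is. With this step the loss
  \<open>2 * B * w\<close> in \<open>chain\<close> is \<open>h / 2\<close>.\<close>

definition chain_len :: nat where "chain_len = nat \<lceil>4 * B * (2 * B + 1)\<rceil>"
definition chain_const :: real where "chain_const = (chain_len + 1) * M"
definition halfway_const :: real where "halfway_const = chain_const + 14 * M + K"
definition halving_const :: real where "halving_const = 2 * (M + halfway_const)"
text \<open>While \<open>h - t\<close> is at least this, half of it leaves room for merging ends at
  distance \<open>halving_const\<close>.\<close>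

definition stop_dist :: real where "stop_dist = 2 * (1 + 2 * B) * halving_const"
definition between_const :: real where "between_const = 2 * (halving_const + stop_dist)"

lemma consts_pos: "0 < chain_const" "0 < halfway_const" "0 < halving_const" "0 < stop_dist" "0 < between_const"
proof -
  show 2: "0 < chain_const"
    using M_pos by (simp add: chain_const_def)
  show 3: "0 < halfway_const"
    using 2 M_pos K_pos by (simp add: halfway_const_def)
  show 4: "0 < halving_const"
    using 3 M_pos by (simp add: halving_const_def)
  show 5: "0 < stop_dist"
    using 4 B_ge_1 by (simp add: stop_dist_def)
  show "0 < between_const"
    using 4 5 by (simp add: between_const_def)
qed

lemma halfway_near:
  fixes \<alpha> \<beta> \<mu> :: "real \<Rightarrow> 'a"
  assumes "geod \<alpha> l" "\<And>s. 0 \<le> s \<Longrightarrow> s \<le> l \<Longrightarrow> h \<le> dist z (\<alpha> s)" "h = dist z (\<alpha> 0)"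
    "geod \<mu> h" "\<mu> 0 = z" "\<mu> h = \<alpha> 0"
    "geod \<beta> (dist z (\<alpha> l))" "\<beta> 0 = z" "\<beta> (dist z (\<alpha> l)) = \<alpha> l" "l \<le> (2 * B + 1) * h"
  shows "dist (\<mu> (h / 2)) (\<beta> (h / 2)) \<le> chain_const"
  unfolding chain_const_def
proof (rule chain[OF assms(1,2)])
  have h: "0 \<le> h"
    using assms(3) by simp
  show "0 \<le> h / (4 * B)"
    using B_ge_1 h by simp
  show "h / 2 \<le> h - 2 * B * (h / (4 * B))"
    using B_ge_1 by (simp add: field_simps)
  have "4 * B * (2 * B + 1) * (h / (4 * B)) \<le> chain_len * (h / (4 * B))"
    using B_ge_1 h by (intro mult_right_mono) (auto simp: chain_len_def intro: of_nat_ceiling)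
  moreover have "4 * B * (2 * B + 1) * (h / (4 * B)) = (2 * B + 1) * h"
    using B_ge_1 by simp
  ultimately show "l \<le> chain_len * (h / (4 * B))"
    using assms(10) by linarith
qed (use assms in auto)

text \<open>A long side is seen from \<open>\<alpha> l\<close>: traversed from there,
  \<open>\<alpha>\<close> and \<open>\<beta>\<close> end at distance \<open>h\<close>, so they are
  still merged at a point \<open>x'\<close> of \<open>\<alpha>\<close> within
  \<open>(2 * B + 1) * h\<close> of \<open>\<alpha> 0\<close>. The short case applies to
  \<open>x'\<close>, and \<open>fan\<close> compares \<open>[z,x']\<close> with
  \<open>\<beta>\<close>.\<close>

lemma halfway:
  fixes \<alpha> \<beta> \<mu> :: "real \<Rightarrow> 'a"
  assumes \<alpha>: "geod \<alpha> l" "\<And>s. 0 \<le> s \<Longrightarrow> s \<le> l \<Longrightarrow> h \<le> dist z (\<alpha> s)" "h = dist z (\<alpha> 0)"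
    and \<mu>: "geod \<mu> h" "\<mu> 0 = z" "\<mu> h = \<alpha> 0"
    and \<beta>: "geod \<beta> (dist z (\<alpha> l))" "\<beta> 0 = z" "\<beta> (dist z (\<alpha> l)) = \<alpha> l"
  shows "dist (\<mu> (h / 2)) (\<beta> (h / 2)) \<le> halfway_const"
proof (cases "l \<le> (2 * B + 1) * h")
  case True
  then show ?thesis
    using halfway_near[OF assms] M_pos K_pos by (simp add: halfway_const_def)
next
  case False
  define Lb where "Lb = dist z (\<alpha> l)"
  have h: "0 \<le> h"
    using \<alpha>(3) by simp
  have Bh: "h \<le> B * h"
    using mult_right_mono[OF B_ge_1 h] by simp
  define s where "s = min l Lb - 2 * B * h"
  have Lb: "\<bar>l - Lb\<bar> \<le> h"
    using dist_triangle[of "\<alpha> 0" "\<alpha> l" z] dist_triangle[of z "\<alpha> l" "\<alpha> 0"] geod_ends[OF \<alpha>(1)] \<alpha>(3)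
    unfolding Lb_def by (simp add: dist_commute)
  have s: "0 \<le> s" "s \<le> l" "s \<le> Lb - h" "l - s \<le> (2 * B + 1) * h"
    using False Lb Bh h by (auto simp: s_def algebra_simps min_def)
  have Ms: "dist (\<alpha> (l - s)) (\<beta> (Lb - s)) \<le> M"
  proof (rule merge_ends[of "\<lambda>t. \<alpha> (l - t)" l "\<lambda>t. \<beta> (Lb - t)" Lb])
    show "geod (\<lambda>t. \<alpha> (l - t)) l" "geod (\<lambda>t. \<beta> (Lb - t)) Lb"
      using geod_rev \<alpha>(1) \<beta>(1) unfolding Lb_def by auto
    show "dist (\<alpha> (l - l)) (\<beta> (Lb - Lb)) \<le> h"
      using \<alpha>(3) \<beta>(2) by (simp add: dist_commute)
  qed (use s \<beta> Lb_def in \<open>auto simp: s_def\<close>)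
  define x' where "x' = \<alpha> (l - s)"
  obtain \<gamma> where \<gamma>: "geod \<gamma> (dist z x')" "\<gamma> 0 = z" "\<gamma> (dist z x') = x'"
    using geodesic by blast
  have "dist (\<mu> (h / 2)) (\<gamma> (h / 2)) \<le> chain_const"
  proof (rule halfway_near)
    show "geod \<alpha> (l - s)"
      using geod_prefix[OF \<alpha>(1)] s by simp
    show "geod \<gamma> (dist z (\<alpha> (l - s)))" "\<gamma> (dist z (\<alpha> (l - s))) = \<alpha> (l - s)"
      using \<gamma> by (auto simp: x'_def)
  qed (use \<alpha> \<mu> s \<gamma> in auto)
  moreover have "dist (\<gamma> (h / 2)) (\<beta> (h / 2)) \<le> 7 * (2 * M) + K"
  proof (rule fan)
    let ?\<tau> = "min (dist z x') (Lb - s)"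
    have \<beta>': "geod \<beta> (Lb - s)"
      using geod_prefix[OF \<beta>(1)] s h by (simp add: Lb_def)
    show "dist (\<gamma> ?\<tau>) (\<beta> ?\<tau>) \<le> 2 * M"
      using dist_at_min(1)[OF \<gamma>(1) \<beta>'] \<gamma> \<beta> Ms by (simp add: x'_def)
    show "geod \<gamma> ?\<tau>"
      using geod_prefix[OF \<gamma>(1)] s h by simp
    show "geod \<beta> ?\<tau>"
      using geod_prefix[OF \<beta>'] s h by simp
    show "h / 2 \<le> ?\<tau>"
      using \<alpha>(2)[of "l - s"] s h by (simp add: x'_def)
  qed (use \<gamma> \<beta> h in auto)
  ultimately show ?thesis
    using dist_triangle[of "\<mu> (h / 2)" "\<beta> (h / 2)" "\<gamma> (h / 2)"] by (simp add: halfway_const_def)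
qed

text \<open>The merging estimate restores the constant \<open>halving_const\<close> after each halving, so errors do not
  accumulate.\<close>

lemma halving_step:
  fixes \<alpha> \<beta> \<mu> :: "real \<Rightarrow> 'a"
  assumes \<alpha>: "geod \<alpha> l" "\<And>s. 0 \<le> s \<Longrightarrow> s \<le> l \<Longrightarrow> h \<le> dist z (\<alpha> s)" "h = dist z (\<alpha> 0)"
    and \<mu>: "geod \<mu> h" "\<mu> 0 = z" "\<mu> h = \<alpha> 0"
    and \<beta>: "geod \<beta> (dist z (\<alpha> l))" "\<beta> 0 = z" "\<beta> (dist z (\<alpha> l)) = \<alpha> l"
    and t: "0 \<le> t" "stop_dist \<le> h - t" "dist (\<beta> t) (\<mu> t) \<le> halving_const"
  shows "dist (\<beta> (t + (h - t) / 2)) (\<mu> (t + (h - t) / 2)) \<le> halving_const"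
proof -
  define k where "k = h - t"
  define u where "u = \<mu> t"
  define L1 where "L1 = dist z (\<alpha> l) - t"
  define L2 where "L2 = dist u (\<alpha> l)"
  have k: "0 < k"
    using t consts_pos by (simp add: k_def)
  have l: "0 \<le> l"
    by (rule geod_nonneg[OF \<alpha>(1)])
  have hx: "h \<le> dist z (\<alpha> l)"
    using \<alpha>(2)[of l] l by simp
  have u: "dist z u = t" "dist u (\<alpha> 0) = k"
    using geod_dist[OF \<mu>(1), of 0 t] geod_dist[OF \<mu>(1), of t h] t \<mu> k
    by (auto simp: u_def k_def)
  \<comment> \<open>Since \<open>u\<close> lies on \<open>\<mu>\<close>, \<open>\<alpha> 0\<close>
    is also nearest to \<open>u\<close>, and \<open>halfway\<close> can be used with
    \<open>u\<close> and \<open>k\<close> for \<open>z\<close> and \<open>h\<close>.\<close>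
  have near: "k \<le> dist u (\<alpha> s)" if "0 \<le> s" "s \<le> l" for s
    using \<alpha>(2)[OF that] dist_triangle[of z "\<alpha> s" u] u by (simp add: k_def)
  obtain \<gamma> where \<gamma>: "geod \<gamma> L2" "\<gamma> 0 = u" "\<gamma> L2 = \<alpha> l"
    using geodesic unfolding L2_def by blast
  have \<mu>': "geod (\<lambda>r. \<mu> (t + r)) k"
    using geod_sub[OF \<mu>(1), of t h] t k by (simp add: k_def)
  have 1: "dist (\<mu> (t + k / 2)) (\<gamma> (k / 2)) \<le> halfway_const"
    using halfway[OF \<alpha>(1), where z = u and h = k, OF near _ \<mu>', of \<gamma>] u \<mu> \<gamma>
    by (simp add: u_def k_def L2_def)
  have \<beta>': "geod (\<lambda>r. \<beta> (t + r)) L1"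
    using geod_sub[OF \<beta>(1), of t "dist z (\<alpha> l)"] t k hx by (simp add: L1_def k_def)
  have L12: "\<bar>L1 - L2\<bar> \<le> halving_const"
    using geod_ends[OF \<beta>'] \<beta> dist_triangle[of "\<beta> t" "\<alpha> l" u] dist_triangle[of u "\<alpha> l" "\<beta> t"] t(3)
    by (simp add: L1_def L2_def u_def dist_commute)
  have k2: "halving_const + 2 * B * halving_const \<le> k / 2"
    using t(2) by (simp add: stop_dist_def k_def algebra_simps)
  have BM: "0 \<le> 2 * B * halving_const"
    using B_ge_1 consts_pos by simp
  \<comment> \<open>Time is counted from the common end \<open>\<alpha> l\<close> of
    \<open>\<beta>\<close> and \<open>\<gamma>\<close>; \<open>L2 - s = k / 2\<close> is the halfway
    time on \<open>\<gamma>\<close>.\<close>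
  define s where "s = L2 - k / 2"
  have s0: "0 \<le> s" "L2 \<ge> k"
    using near[of l] l k by (auto simp: s_def L2_def)
  have "dist (\<beta> (t + (L1 - s))) (\<gamma> (L2 - s)) \<le> M"
  proof (rule merge_ends[of "\<lambda>r. \<beta> (t + (L1 - r))" L1 "\<lambda>r. \<gamma> (L2 - r)" L2])
    show "geod (\<lambda>r. \<beta> (t + (L1 - r))) L1" "geod (\<lambda>r. \<gamma> (L2 - r)) L2"
      using geod_rev \<beta>' \<gamma>(1) by blast+
    show "dist (\<beta> (t + (L1 - L1))) (\<gamma> (L2 - L2)) \<le> halving_const"
      using t(3) \<gamma> by (simp add: u_def)
  qed (use s0 k2 L12 \<gamma> \<beta> BM consts_pos in \<open>auto simp: s_def L1_def\<close>)
  then have 2: "dist (\<beta> (t + (L1 - s))) (\<mu> (t + k / 2)) \<le> M + halfway_const"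
    using 1 dist_triangle[of "\<beta> (t + (L1 - s))" "\<mu> (t + k / 2)" "\<gamma> (k / 2)"]
    by (simp add: s_def dist_commute)
  \<comment> \<open>\<open>\<beta>\<close> is met at another time; as \<open>\<beta>\<close> and
    \<open>\<mu>\<close> both start at \<open>z\<close>, equal times cost a factor 2.\<close>
  have "dist (\<beta> (t + k / 2)) (\<mu> (t + k / 2)) \<le> 2 * (M + halfway_const)"
  proof (rule dist_same_time[OF \<beta>(1) \<mu>(1) _ _ _ _ _ _ 2])
    show "\<beta> 0 = \<mu> 0" "0 \<le> t + k / 2" "t + k / 2 \<le> h"
      using \<mu> \<beta> t k by (auto simp: k_def field_simps)
    then show "t + k / 2 \<le> dist z (\<alpha> l)"
      using hx by simp
    show "0 \<le> t + (L1 - s)" "t + (L1 - s) \<le> dist z (\<alpha> l)"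
      using L12 k2 t s0 BM consts_pos by (auto simp: s_def L1_def)
  qed
  then show ?thesis
    by (simp add: halving_const_def k_def)
qed

lemma halving:
  fixes \<alpha> \<beta> \<mu> :: "real \<Rightarrow> 'a"
  assumes \<alpha>: "geod \<alpha> l" "\<And>s. 0 \<le> s \<Longrightarrow> s \<le> l \<Longrightarrow> h \<le> dist z (\<alpha> s)" "h = dist z (\<alpha> 0)"
    and \<mu>: "geod \<mu> h" "\<mu> 0 = z" "\<mu> h = \<alpha> 0"
    and \<beta>: "geod \<beta> (dist z (\<alpha> l))" "\<beta> 0 = z" "\<beta> (dist z (\<alpha> l)) = \<alpha> l"
    and t: "0 \<le> t" "t \<le> h" "dist (\<beta> t) (\<mu> t) \<le> halving_const" "h - t \<le> 2 ^ n * stop_dist"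
  shows "\<exists>t. 0 \<le> t \<and> t \<le> h \<and> h - t \<le> stop_dist \<and> dist (\<beta> t) (\<mu> t) \<le> halving_const"
  using t
proof (induction n arbitrary: t)
  case 0
  then show ?case by auto
next
  case (Suc n)
  show ?case
  proof (cases "h - t \<le> stop_dist")
    case True
    then show ?thesis using Suc.prems by auto
  next
    case False
    have "dist (\<beta> (t + (h - t) / 2)) (\<mu> (t + (h - t) / 2)) \<le> halving_const"
      using halving_step[OF \<alpha> \<mu> \<beta>, of t] Suc.prems False by simp
    then show ?thesis
      using Suc.prems by (intro Suc.IH[of "t + (h - t) / 2"]) (auto simp: field_simps)
  qed
qed

text \<open>Halving, started at time 0, shows that \<open>[z, \<alpha> l]\<close> passes within a
  bounded distance of \<open>\<alpha> 0\<close>, so the detour through that point is short.\<close>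

lemma nearest_point_between:
  fixes \<alpha> :: "real \<Rightarrow> 'a"
  assumes \<alpha>: "geod \<alpha> l" "\<And>s. 0 \<le> s \<Longrightarrow> s \<le> l \<Longrightarrow> dist z (\<alpha> 0) \<le> dist z (\<alpha> s)"
  shows "dist z (\<alpha> 0) + l \<le> dist z (\<alpha> l) + between_const"
proof -
  define h where "h = dist z (\<alpha> 0)"
  obtain \<mu> where \<mu>: "geod \<mu> h" "\<mu> 0 = z" "\<mu> h = \<alpha> 0"
    using geodesic unfolding h_def by blast
  obtain \<beta> where \<beta>: "geod \<beta> (dist z (\<alpha> l))" "\<beta> 0 = z" "\<beta> (dist z (\<alpha> l)) = \<alpha> l"
    using geodesic by blast
  obtain n where "h / stop_dist < 2 ^ n"
    using real_arch_pow[of 2 "h / stop_dist"] by auto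
  then have n: "h \<le> 2 ^ n * stop_dist"
    using consts_pos by (simp add: field_simps)
  have far: "h \<le> dist z (\<alpha> s)" if "0 \<le> s" "s \<le> l" for s
    using \<alpha>(2)[OF that] by (simp add: h_def)
  have "0 \<le> h"
    by (simp add: h_def)
  then obtain t where t: "0 \<le> t" "t \<le> h" "h - t \<le> stop_dist" "dist (\<beta> t) (\<mu> t) \<le> halving_const"
    using halving[OF \<alpha>(1) far h_def \<mu> \<beta>, of 0 n] \<mu> \<beta> n consts_pos by auto
  have hx: "h \<le> dist z (\<alpha> l)"
    using far[of l] geod_nonneg[OF \<alpha>(1)] by simp
  have "dist (\<beta> t) (\<alpha> 0) \<le> halving_const + stop_dist"
    using t geod_dist[OF \<mu>(1), of t h] \<mu> dist_triangle[of "\<beta> t" "\<alpha> 0" "\<mu> t"] by simp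
  moreover have "dist (\<beta> t) (\<alpha> l) = dist z (\<alpha> l) - t"
    using geod_dist[OF \<beta>(1), of t "dist z (\<alpha> l)"] \<beta> t hx by simp
  ultimately show ?thesis
    using dist_triangle[of "\<alpha> 0" "\<alpha> l" "\<beta> t"] geod_ends[OF \<alpha>(1)] t consts_pos
    by (simp add: between_const_def h_def dist_commute)
qed

section \<open>Slim triangles\<close>

lemma leg_close:
  fixes \<alpha> \<beta> :: "real \<Rightarrow> 'a"
  assumes \<alpha>: "geod \<alpha> l" "\<And>s. 0 \<le> s \<Longrightarrow> s \<le> l \<Longrightarrow> dist z (\<alpha> 0) \<le> dist z (\<alpha> s)"
    and \<beta>: "geod \<beta> L" "\<beta> 0 = \<alpha> l" "\<beta> L = z" and s: "0 \<le> s" "s \<le> l"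
  shows "\<exists>r\<in>{0..L}. dist (\<alpha> s) (\<beta> r) \<le> 7 * between_const + K"
proof -
  have L: "L = dist z (\<alpha> l)" "0 \<le> L"
    using geod_ends[OF \<beta>(1)] geod_nonneg[OF \<beta>(1)] \<beta> by (auto simp: dist_commute)
  have "dist z (\<alpha> 0) + l \<le> L + between_const"
    unfolding L(1) using \<alpha> by (rule nearest_point_between)
  moreover have "dist z (\<alpha> s) \<le> dist z (\<alpha> 0) + s" "dist (\<alpha> l) (\<alpha> s) = l - s"
    using dist_triangle[of z "\<alpha> s" "\<alpha> 0"] geod_dist[OF \<alpha>(1), of 0 s] geod_dist[OF \<alpha>(1), of l s] s
    by auto
  moreover from calculation have "l \<le> L + between_const"
    using zero_le_dist[of z "\<alpha> 0"] by linarith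
  \<comment> \<open>\<open>\<alpha> s\<close> is a lens point for \<open>\<beta>\<close> with
    \<open>between_const\<close> as \<open>\<rho>\<close>; \<open>l - s\<close> is cut at
    \<open>L\<close>, which it exceeds by at most \<open>between_const\<close>.\<close>
  ultimately have "dist (\<alpha> s) (\<beta> (min (l - s) L)) \<le> 7 * between_const + K"
    using s L(2) \<beta> consts_pos by (intro lens[OF \<beta>(1)]) (auto simp: min_def)
  then show ?thesis
    using s L(2) by (intro bexI[of _ "min (l - s) L"]) auto
qed

text \<open>A point of \<open>Gxy\<close> nearest to \<open>z\<close> splits the side into two legs,
  each of which stays near one of the other sides. The \<open>+ 1\<close> is due to the strict
  inequality in \<open>nbhd\<close>.\<close>

lemma slim_side:
  fixes x y z :: 'a
  assumes "geodesic_segment_between Gxy x y" "geodesic_segment_between Gxz x z"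
    "geodesic_segment_between Gyz y z"
  shows "Gxy \<subseteq> nbhd (7 * between_const + K + 1) (Gxz \<union> Gyz)"
proof
  fix p assume "p \<in> Gxy"
  define L where "L = dist x y"
  obtain g where g: "geod g L" "g 0 = x" "g L = y" "Gxy = g ` {0..L}"
    using assms(1) unfolding segment_iff_geod L_def by blast
  obtain \<beta> where \<beta>: "geod \<beta> (dist x z)" "\<beta> 0 = x" "\<beta> (dist x z) = z" "Gxz = \<beta> ` {0..dist x z}"
    using assms(2) unfolding segment_iff_geod by blast
  obtain \<gamma> where \<gamma>: "geod \<gamma> (dist y z)" "\<gamma> 0 = y" "\<gamma> (dist y z) = z" "Gyz = \<gamma> ` {0..dist y z}"
    using assms(3) unfolding segment_iff_geod by blast
  obtain a where a: "p = g a" "0 \<le> a" "a \<le> L"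
    using \<open>p \<in> Gxy\<close> g(4) by auto
  have "1-lipschitz_on {0..L} g"
    using geod_dist[OF g(1)] by (intro lipschitz_onI) (auto simp: dist_real_def)
  then have "continuous_on {0..L} (\<lambda>t. dist z (g t))"
    by (intro continuous_intros) (rule lipschitz_on_continuous_on)
  then obtain m where m: "0 \<le> m" "m \<le> L" "\<And>t. 0 \<le> t \<Longrightarrow> t \<le> L \<Longrightarrow> dist z (g m) \<le> dist z (g t)"
    using continuous_attains_inf[of "{0..L}" "\<lambda>t. dist z (g t)"] a by auto
  have "\<exists>q\<in>Gxz \<union> Gyz. dist p q \<le> 7 * between_const + K"
  proof (cases "a \<le> m")
    case True
    have "\<exists>r\<in>{0..dist x z}. dist (g (m - (m - a))) (\<beta> r) \<le> 7 * between_const + K"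
    proof (rule leg_close[of "\<lambda>s. g (m - s)" m])
      show "geod (\<lambda>s. g (m - s)) m"
        using geod_rev geod_prefix g(1) m by blast
    qed (use m \<beta> g a True in auto)
    then show ?thesis
      using \<beta>(4) a by auto
  next
    case False
    have "\<exists>r\<in>{0..dist y z}. dist (g (m + (a - m))) (\<gamma> r) \<le> 7 * between_const + K"
    proof (rule leg_close[of "\<lambda>s. g (m + s)" "L - m"])
      show "geod (\<lambda>s. g (m + s)) (L - m)"
        using geod_sub g(1) m by blast
    qed (use m \<gamma> g a False in auto)
    then show ?thesis
      using \<gamma>(4) a by auto
  qed
  then show "p \<in> nbhd (7 * between_const + K + 1) (Gxz \<union> Gyz)"
    unfolding nbhd_def by force
qed

lemma hyperbolic: "hyperbolic TYPE('a)"
  unfolding hyperbolic_def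
proof (intro exI conjI)
  show "0 \<le> 7 * between_const + K + 1"
    using consts_pos K_pos by simp
  then show "delta_hyperbolic TYPE('a) (7 * between_const + K + 1)"
    unfolding delta_hyperbolic_def
    by (metis slim_side geodesic_segment_commute sup_commute)
qed

end

section \<open>Intersections of balls\<close>

lemma nbhd_mono: "r \<le> r' \<Longrightarrow> nbhd r A \<subseteq> nbhd r' A"
  unfolding nbhd_def by force

lemma subset_nbhd_bounded:
  assumes "bounded A" "bounded B" "B \<noteq> {}"
  shows "\<exists>r\<ge>0. A \<subseteq> nbhd r B"
proof -
  obtain b where b: "b \<in> B"
    using assms by blast
  obtain e where e: "\<And>a. a \<in> A \<Longrightarrow> dist b a \<le> e"
    using assms(1) bounded_any_center[of A b] by auto
  have "A \<subseteq> nbhd (\<bar>e\<bar> + 1) B"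
    unfolding nbhd_def using b e by (force simp: dist_commute)
  then show ?thesis
    by (intro exI[of _ "\<bar>e\<bar> + 1"]) simp
qed

text \<open>Boundedness and nonemptiness make the set of radii nonempty, so that its
  \<open>Inf\<close> is meaningful; it may not be attained, hence \<open>C'\<close>.\<close>

lemma hausdorff_dist_leD:
  assumes "hausdorff_dist A B \<le> C" "C < C'" "bounded A" "bounded B" "A \<noteq> {}" "B \<noteq> {}"
  shows "A \<subseteq> nbhd C' B" "B \<subseteq> nbhd C' A"
proof -
  let ?S = "{r. r \<ge> 0 \<and> A \<subseteq> nbhd r B \<and> B \<subseteq> nbhd r A}"
  obtain r1 r2 where "0 \<le> r1" "A \<subseteq> nbhd r1 B" "0 \<le> r2" "B \<subseteq> nbhd r2 A"
    using subset_nbhd_bounded assms by meson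
  then have "max r1 r2 \<in> ?S"
    using nbhd_mono[of r1 "max r1 r2" B] nbhd_mono[of r2 "max r1 r2" A] by auto
  then obtain r where r: "r \<in> ?S" "r < C'"
    using assms(1,2) cInf_lessD[of ?S C'] unfolding hausdorff_dist_def by force
  then show "A \<subseteq> nbhd C' B" "B \<subseteq> nbhd C' A"
    using nbhd_mono[of r C'] by force+
qed

lemma hausdorff_dist_leI:
  assumes "0 \<le> r" "A \<subseteq> nbhd r B" "B \<subseteq> nbhd r A"
  shows "hausdorff_dist A B \<le> r"
  unfolding hausdorff_dist_def using assms by (intro cInf_lower bdd_belowI[of _ 0]) auto

text \<open>Lens points have distance at least \<open>\<tau> - \<rho>\<close> from
  \<open>g 0\<close>, and \<open>\<xi>\<close> at most \<open>\<tau> + \<rho> + (C + 1)\<close>. So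
  a walk from \<open>\<xi>\<close> to \<open>g 0\<close> within the ball has length at most
  \<open>2 * \<rho> + 2 * (C + 1)\<close>.\<close>

lemma lens_bound:
  fixes g :: "real \<Rightarrow> 'a::metric_space"
  assumes geo: "geodesic_space TYPE('a)"
    and C: "\<forall>(x::'a) y s t. s \<ge> 0 \<and> t \<ge> 0 \<and> cball x s \<inter> cball y t \<noteq> {} \<longrightarrow>
        (\<exists>\<xi> R. R \<ge> 0 \<and> hausdorff_dist (cball x s \<inter> cball y t) (cball \<xi> R) \<le> C)"
    and g: "geod g L" and \<tau>: "0 \<le> \<tau>" "\<tau> \<le> L" and \<rho>: "0 \<le> \<rho>"
    and z: "dist (g 0) z \<le> \<tau> + \<rho>" "dist (g L) z \<le> L - \<tau> + \<rho>"
  shows "dist z (g \<tau>) \<le> 7 * \<rho> + 6 * (C + 1)"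
proof -
  let ?A = "cball (g 0) (\<tau> + \<rho>) \<inter> cball (g L) (L - \<tau> + \<rho>)"
  have m: "dist (g 0) (g \<tau>) = \<tau>" "dist (g L) (g \<tau>) = L - \<tau>"
    using geod_dist[OF g, of 0 \<tau>] geod_dist[OF g, of L \<tau>] \<tau> by auto
  have A: "z \<in> ?A" "g \<tau> \<in> ?A"
    using z m \<rho> by auto
  then have "\<exists>\<xi> R. R \<ge> 0 \<and> hausdorff_dist ?A (cball \<xi> R) \<le> C"
    using \<tau> \<rho> by (intro C[rule_format] conjI) auto
  then obtain \<xi> R where R: "0 \<le> R" "hausdorff_dist ?A (cball \<xi> R) \<le> C"
    by blast
  have "bounded ?A" "cball \<xi> R \<noteq> {}" "?A \<noteq> {}"
    using bounded_cball bounded_Int R(1) A by (auto simp del: mem_cball)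
  then have sub: "?A \<subseteq> nbhd (C + 1) (cball \<xi> R)" "cball \<xi> R \<subseteq> nbhd (C + 1) ?A"
    using hausdorff_dist_leD[OF R(2) less_add_one _ bounded_cball] by blast+
  have in_ball: "dist a \<xi> \<le> R + (C + 1)" if a: "a \<in> ?A" for a
  proof -
    obtain b where "b \<in> cball \<xi> R" "dist a b < C + 1"
      using sub(1) a unfolding nbhd_def by blast
    then show ?thesis
      using dist_triangle[of a \<xi> b] by (simp add: dist_commute)
  qed
  have near: "\<exists>a\<in>?A. dist b a < C + 1" if "b \<in> cball \<xi> R" for b
    using sub(2) that unfolding nbhd_def by blast
  obtain a0 where a0: "a0 \<in> ?A" "dist \<xi> a0 < C + 1"
    using near[of \<xi>] R(1) by auto
  have far: "\<tau> - \<rho> \<le> dist (g 0) a" if "a \<in> ?A" for a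
    using that dist_triangle[of "g 0" "g L" a] geod_ends[OF g] by (simp add: dist_commute)
  define D where "D = dist \<xi> (g 0)"
  define R' where "R' = min R D"
  obtain \<sigma> where \<sigma>: "geod \<sigma> D" "\<sigma> 0 = \<xi>" "\<sigma> D = g 0"
    using geodesic_spaceE[OF geo, of \<xi> "g 0"] unfolding D_def by blast
  have R': "0 \<le> R'" "R' \<le> D" "R' \<le> R"
    using R(1) by (auto simp: R'_def D_def)
  have p: "dist \<xi> (\<sigma> R') = R'" "dist (g 0) (\<sigma> R') = D - R'"
    using geod_dist[OF \<sigma>(1), of 0 R'] geod_dist[OF \<sigma>(1), of D R'] R' \<sigma> by auto
  then obtain a where a: "a \<in> ?A" "dist (\<sigma> R') a < C + 1"
    using near[of "\<sigma> R'"] R' by auto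
  have D: "D \<le> \<tau> + \<rho> + (C + 1)"
    using a0 dist_triangle[of "g 0" \<xi> a0] by (simp add: D_def dist_commute)
  have R'_le: "R' \<le> 2 * \<rho> + 2 * (C + 1)"
    using far[OF a(1)] a(2) p D dist_triangle[of "g 0" a "\<sigma> R'"] by simp
  show ?thesis
  proof (cases "R \<le> D")
    case True
    then show ?thesis
      using R'_le in_ball[OF A(1)] in_ball[OF A(2)] dist_triangle2[of z "g \<tau>" \<xi>] \<rho>
      by (simp add: R'_def)
  next
    case False
    \<comment> \<open>The walk reaches \<open>g 0\<close> and does not bound \<open>R\<close>, but
      now \<open>\<tau>\<close> is small, and \<open>2 * \<tau> + \<rho>\<close> gives the factor
      7.\<close>
    then have "D \<le> 2 * \<rho> + 2 * (C + 1)"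
      using R'_le by (simp add: R'_def)
    then have "\<tau> \<le> 3 * \<rho> + 3 * (C + 1)"
      using far[OF a0(1)] a0(2) dist_triangle[of "g 0" a0 \<xi>] by (simp add: D_def dist_commute)
    then show ?thesis
      using z(1) m dist_triangle3[of z "g \<tau>" "g 0"] by simp
  qed
qed

text \<open>With \<open>R\<close> half the overlap, \<open>cball \<xi> R\<close> lies in both balls.
  For \<open>z\<close> in both, \<open>\<xi>\<close> is within \<open>\<delta>\<close> of some
  \<open>q\<close> on \<open>[x,z]\<close> or \<open>[y,z]\<close>; as \<open>q\<close> is almost as
  far from \<open>x\<close> or \<open>y\<close> as \<open>\<xi>\<close> is, at most
  \<open>R + \<delta>\<close> remains from \<open>q\<close> to \<open>z\<close>.\<close>

lemma inter_cball_near_cball: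
  fixes x y :: "'a::metric_space"
  assumes geo: "geodesic_space TYPE('a)" and hyp: "delta_hyperbolic TYPE('a) \<delta>"
    and st: "0 \<le> s" "0 \<le> t" "cball x s \<inter> cball y t \<noteq> {}"
  shows "\<exists>\<xi> R. R \<ge> 0 \<and> hausdorff_dist (cball x s \<inter> cball y t) (cball \<xi> R) \<le> 2 * \<delta> + 1"
proof -
  have \<delta>: "0 \<le> \<delta>"
    using hyp by (simp add: delta_hyperbolic_def)
  have refl: "hausdorff_dist A A \<le> 2 * \<delta> + 1" for A :: "'a set"
    using \<delta> by (intro hausdorff_dist_leI) (auto simp: nbhd_def intro!: bexI)
  define D where "D = dist x y"
  obtain w where "w \<in> cball x s" "w \<in> cball y t"
    using st(3) by blast
  then have D: "D \<le> s + t"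
    using dist_triangle2[of x y w] by (simp add: D_def)
  \<comment> \<open>In the first two cases one ball contains the other; excluding them puts the time
    \<open>s - R\<close> of \<open>\<xi>\<close> into \<open>{0..D}\<close>.\<close>
  consider "D + t \<le> s" | "D + s \<le> t" | "s < D + t" "t < D + s"
    by linarith
  then show ?thesis
  proof cases
    case 1
    then have "cball y t \<subseteq> cball x s"
      unfolding subset_iff mem_cball D_def
      by (metis add_left_mono dist_triangle order_trans)
    then have "cball x s \<inter> cball y t = cball y t"
      by blast
    then show ?thesis
      using refl st by metis
  next
    case 2
    then have "cball x s \<subseteq> cball y t"
      unfolding subset_iff mem_cball D_def
      by (metis add_left_mono dist_commute dist_triangle order_trans)
    then have "cball x s \<inter> cball y t = cball x s"
      by blast
    then show ?thesis
      using refl st by metis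
  next
    case 3
    define R where "R = (s + t - D) / 2"
    obtain g where g: "geod g D" "g 0 = x" "g D = y"
      using geodesic_spaceE[OF geo] D_def by metis
    define \<xi> where "\<xi> = g (s - R)"
    have R: "0 \<le> R" "0 \<le> s - R" "s - R \<le> D"
      using D 3 by (auto simp: R_def field_simps)
    have \<xi>: "dist x \<xi> = s - R" "dist y \<xi> = t - R"
      using geod_dist[OF g(1), of 0 "s - R"] geod_dist[OF g(1), of D "s - R"] R g
      by (auto simp: \<xi>_def R_def field_simps)
    have sub: "cball \<xi> R \<subseteq> cball x s \<inter> cball y t"
    proof
      fix z assume "z \<in> cball \<xi> R"
      then show "z \<in> cball x s \<inter> cball y t"
        using \<xi> dist_triangle[of x z \<xi>] dist_triangle[of y z \<xi>] by simp
    qed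
    have near: "dist z \<xi> \<le> R + 2 * \<delta>" if z: "z \<in> cball x s \<inter> cball y t" for z
    proof -
      obtain a where a: "geod a (dist x z)" "a 0 = x" "a (dist x z) = z"
        using geodesic_spaceE[OF geo] by blast
      obtain b where b: "geod b (dist y z)" "b 0 = y" "b (dist y z) = z"
        using geodesic_spaceE[OF geo] by blast
      have "g ` {0..D} \<subseteq> nbhd \<delta> (b ` {0..dist y z} \<union> a ` {0..dist x z})"
        using hyp geod_imp_segment[OF g] geod_imp_segment[OF a] geod_imp_segment[OF b]
        unfolding delta_hyperbolic_def by blast
      then have "\<xi> \<in> nbhd \<delta> (b ` {0..dist y z} \<union> a ` {0..dist x z})"
        using R by (auto simp: \<xi>_def)
      then obtain q where q: "q \<in> b ` {0..dist y z} \<union> a ` {0..dist x z}" "dist \<xi> q < \<delta>"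
        unfolding nbhd_def by blast
      then consider r where "q = b r" "0 \<le> r" "r \<le> dist y z"
        | r where "q = a r" "0 \<le> r" "r \<le> dist x z"
        by auto
      then show ?thesis
      proof cases
        case 1
        then have "dist y q = r" "dist q z = dist y z - r"
          using geod_dist[OF b(1), of 0 r] geod_dist[OF b(1), of r "dist y z"] b by auto
        then show ?thesis
          using z q(2) \<xi> dist_triangle[of z \<xi> q] dist_triangle[of y \<xi> q] by (simp add: dist_commute)
      next
        case 2
        then have "dist x q = r" "dist q z = dist x z - r"
          using geod_dist[OF a(1), of 0 r] geod_dist[OF a(1), of r "dist x z"] a by auto
        then show ?thesis
          using z q(2) \<xi> dist_triangle[of z \<xi> q] dist_triangle[of x \<xi> q] by (simp add: dist_commute)
      qed
    qed
    have "hausdorff_dist (cball x s \<inter> cball y t) (cball \<xi> R) \<le> 2 * \<delta> + 1"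
    proof (rule hausdorff_dist_leI)
      show "cball \<xi> R \<subseteq> nbhd (2 * \<delta> + 1) (cball x s \<inter> cball y t)"
        using sub \<delta> by (force simp: nbhd_def intro!: bexI)
      show "cball x s \<inter> cball y t \<subseteq> nbhd (2 * \<delta> + 1) (cball \<xi> R)"
      proof
        fix z assume z: "z \<in> cball x s \<inter> cball y t"
        define h where "h = dist \<xi> z"
        obtain a where a: "geod a h" "a 0 = \<xi>" "a h = z"
          using geodesic_spaceE[OF geo] h_def by metis
        have h: "0 \<le> h" "h \<le> R + 2 * \<delta>"
          using near[OF z] by (auto simp: h_def dist_commute)
        have "dist \<xi> (a (min h R)) = min h R" "dist z (a (min h R)) = h - min h R"
          using geod_dist[OF a(1), of 0 "min h R"] geod_dist[OF a(1), of h "min h R"] a h R by auto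
        then show "z \<in> nbhd (2 * \<delta> + 1) (cball \<xi> R)"
          unfolding nbhd_def using h \<delta> by (intro CollectI bexI[of _ "a (min h R)"]) auto
      qed
    qed (use \<delta> in simp)
    then show ?thesis
      using R by blast
  qed
qed

theorem theorem1:
  assumes "geodesic_space TYPE('a::metric_space)"
  shows "hyperbolic TYPE('a) \<longleftrightarrow>
    (\<exists>C\<ge>0. \<forall>(x::'a) y s t. s \<ge> 0 \<and> t \<ge> 0 \<and> cball x s \<inter> cball y t \<noteq> {} \<longrightarrow>
        (\<exists>\<xi> R. R \<ge> 0 \<and> hausdorff_dist (cball x s \<inter> cball y t) (cball \<xi> R) \<le> C))"
  (is "_ \<longleftrightarrow> (\<exists>C\<ge>0. ?P C)")
proof
  assume "hyperbolic TYPE('a)"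
  then obtain \<delta> where \<delta>: "0 \<le> \<delta>" "delta_hyperbolic TYPE('a) \<delta>"
    by (auto simp: hyperbolic_def)
  then show "\<exists>C\<ge>0. ?P C"
    using inter_cball_near_cball[OF assms \<delta>(2)] by (intro exI[of _ "2 * \<delta> + 1"]) auto
next
  assume "\<exists>C\<ge>0. ?P C"
  then obtain C where C: "0 \<le> C" "?P C"
    by blast
  interpret lens_space "TYPE('a)" "6 * (C + 1)"
  proof
    show "0 < 6 * (C + 1)"
      using C by simp
    show "\<exists>g. geod g (dist x y) \<and> g 0 = x \<and> g (dist x y) = y" for x y :: 'a
      using geodesic_spaceE[OF assms] by metis
  qed (rule lens_bound[OF assms C(2)])
  show "hyperbolic TYPE('a)"
    by (rule hyperbolic)
qed

end
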